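(* Let $k$ be a field of any characteristic, let $V$ be a finite-dimensional vector space over $k$, and let $d$ be a nonnegative integer. Let $\varphi: V\to V$ be a linear map and let $w\in V$ be an eigenvector of $\varphi$ associated with an eigenvalue $\lambda\in k$. Then $S^d(V^* )$, equipped with the bracket $$[f,g]:=g(w)\,\varphi_d^*(f)-f(w)\,\varphi_d^*(g)\qquad (f,g\in S^d(V^* )),$$ is a solvable Lie algebra over $k$. Moreover, if $\varphi$ is nilpotent, then this Lie algebra is nilpotent.
   Context: $S^d(V^* )$ denotes the $d$-th symmetric power of the dual space $V^*$. Choosing a basis of $V$ with dual basis $x_1,\dots,x_n$ of $V^*$, it is identified with the space of homogeneous polynomials of degree $d$ in $k[x_1,\dots,x_n]$; elements $f$ are evaluated at vectors $v\in V$, giving $f(v)\in k$. For a linear map $\varphi:V\to V$, $\varphi_d^*:S^d(V^* )\to S^d(V^* )$ denotes the linear map induced by $\varphi$, i.e. $\varphi_d^*(f)=f\circ\varphi$, $\varphi_d^*(f)(v)=f(\varphi(v))$ for all $v\in V$ (as polynomials, it is given by substituting $x_i\mapsto x_i\circ\varphi\in V^*$). *)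

theory Defs
  imports Complex_Main "HOL-Library.Poly_Mapping"
begin

section \<open>Lie algebras over a field\<close>

text \<open>
  A Lie algebra is carried by a subspace \<open>L\<close> of an ambient vector space; the bracket is a function
  on the ambient type of which only the restriction to \<open>L\<close> matters.
\<close>

locale lie_algebra = vector_space scale
  for scale :: "'k::field \<Rightarrow> 'a::ab_group_add \<Rightarrow> 'a" (infixr \<open>*s\<close> 75) +
  fixes L :: "'a set" and bracket :: "'a \<Rightarrow> 'a \<Rightarrow> 'a"
  assumes subspace_carrier: "subspace L"
    and bracket_closed: "x \<in> L \<Longrightarrow> y \<in> L \<Longrightarrow> bracket x y \<in> L"
    and bracket_add_left:
      "x \<in> L \<Longrightarrow> y \<in> L \<Longrightarrow> z \<in> L \<Longrightarrow> bracket (x + y) z = bracket x z + bracket y z"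
    and bracket_add_right:
      "x \<in> L \<Longrightarrow> y \<in> L \<Longrightarrow> z \<in> L \<Longrightarrow> bracket x (y + z) = bracket x y + bracket x z"
    and bracket_scale_left:
      "x \<in> L \<Longrightarrow> y \<in> L \<Longrightarrow> bracket (c *s x) y = c *s bracket x y"
    and bracket_scale_right:
      "x \<in> L \<Longrightarrow> y \<in> L \<Longrightarrow> bracket x (c *s y) = c *s bracket x y"
    and bracket_self: "x \<in> L \<Longrightarrow> bracket x x = 0"
    and jacobi: "x \<in> L \<Longrightarrow> y \<in> L \<Longrightarrow> z \<in> L \<Longrightarrow>
      bracket x (bracket y z) + bracket y (bracket z x) + bracket z (bracket x y) = 0"
begin

definition bracket_span :: "'a set \<Rightarrow> 'a set \<Rightarrow> 'a set" where
  "bracket_span A B = span {bracket x y | x y. x \<in> A \<and> y \<in> B}"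

primrec derived_series :: "nat \<Rightarrow> 'a set" where
  "derived_series 0 = L"
| "derived_series (Suc n) = bracket_span (derived_series n) (derived_series n)"

primrec lower_central_series :: "nat \<Rightarrow> 'a set" where
  "lower_central_series 0 = L"
| "lower_central_series (Suc n) = bracket_span L (lower_central_series n)"

end

locale solvable_lie_algebra = lie_algebra +
  assumes solvable: "\<exists>n. derived_series n = {0}"

locale nilpotent_lie_algebra = lie_algebra +
  assumes nilpotent: "\<exists>n. lower_central_series n = {0}"


section \<open>Polynomials in variables indexed by a type\<close>

text \<open>
  A monomial is a finitely supported exponent vector and a polynomial a finitely supported family
  of coefficients indexed by monomials. Polynomials are formal objects, so that nothing is lost
  over a finite field, where distinct polynomials may define the same function.
\<close>

type_synonym ('v, 'k) mpoly = "('v \<Rightarrow>\<^sub>0 nat) \<Rightarrow>\<^sub>0 'k"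

definition mpoly_const :: "'k::zero \<Rightarrow> ('v, 'k) mpoly" where
  "mpoly_const c = Poly_Mapping.single 0 c"

definition mpoly_var :: "'v \<Rightarrow> ('v, 'k::zero_neq_one) mpoly" where
  "mpoly_var x = Poly_Mapping.single (Poly_Mapping.single x 1) 1"

definition mpoly_scale :: "'k::comm_ring_1 \<Rightarrow> ('v, 'k) mpoly \<Rightarrow> ('v, 'k) mpoly" where
  "mpoly_scale c p = mpoly_const c * p"

text \<open>
  The ring homomorphism out of the polynomial ring which is \<open>h\<close> on coefficients and \<open>\<sigma>\<close> on
  variables.
\<close>

definition mpoly_hom ::
    "('k::zero \<Rightarrow> 'r::comm_ring_1) \<Rightarrow> ('v \<Rightarrow> 'r) \<Rightarrow> ('v, 'k) mpoly \<Rightarrow> 'r" where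
  "mpoly_hom h \<sigma> p =
    (\<Sum>m\<in>Poly_Mapping.keys p. h (Poly_Mapping.lookup p m) *
      (\<Prod>x\<in>Poly_Mapping.keys m. \<sigma> x ^ Poly_Mapping.lookup m x))"


section \<open>Symmetric powers of the dual space\<close>

text \<open>
  For a basis \<open>B\<close> of \<open>V\<close>, the variable indexed by \<open>b \<in> B\<close> stands for the member \<^term>\<open>coord scale B b\<close>
  of the dual basis.
\<close>

definition coord ::
    "('k::field \<Rightarrow> 'v::ab_group_add \<Rightarrow> 'v) \<Rightarrow> 'v set \<Rightarrow> 'v \<Rightarrow> 'v \<Rightarrow> 'k" where
  "coord scale B b v = module.representation scale B v b"

definition sym_power_dual :: "'v set \<Rightarrow> nat \<Rightarrow> ('v, 'k::field) mpoly set" where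
  "sym_power_dual B d =
    {p. \<forall>m\<in>Poly_Mapping.keys p. Poly_Mapping.keys m \<subseteq> B \<and>
      (\<Sum>b\<in>Poly_Mapping.keys m. Poly_Mapping.lookup m b) = d}"

definition sym_eval ::
    "('k::field \<Rightarrow> 'v::ab_group_add \<Rightarrow> 'v) \<Rightarrow> 'v set \<Rightarrow> ('v, 'k) mpoly \<Rightarrow> 'v \<Rightarrow> 'k" where
  "sym_eval scale B f v = mpoly_hom (\<lambda>c. c) (\<lambda>b. coord scale B b v) f"

text \<open>
  A linear functional \<open>l\<close>, expanded in the dual basis, as a linear form.
\<close>

definition functional_poly :: "'v set \<Rightarrow> ('v \<Rightarrow> 'k::field) \<Rightarrow> ('v, 'k) mpoly" where
  "functional_poly B l = (\<Sum>b\<in>B. mpoly_scale (l b) (mpoly_var b))"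

definition sym_pullback ::
    "('k::field \<Rightarrow> 'v::ab_group_add \<Rightarrow> 'v) \<Rightarrow> 'v set \<Rightarrow> ('v \<Rightarrow> 'v) \<Rightarrow>
      ('v, 'k) mpoly \<Rightarrow> ('v, 'k) mpoly" where
  "sym_pullback scale B \<phi> f =
    mpoly_hom mpoly_const (\<lambda>b. functional_poly B (coord scale B b \<circ> \<phi>)) f"

definition sym_bracket ::
    "('k::field \<Rightarrow> 'v::ab_group_add \<Rightarrow> 'v) \<Rightarrow> 'v set \<Rightarrow> ('v \<Rightarrow> 'v) \<Rightarrow> 'v \<Rightarrow>
      ('v, 'k) mpoly \<Rightarrow> ('v, 'k) mpoly \<Rightarrow> ('v, 'k) mpoly" where
  "sym_bracket scale B \<phi> w f g =
    mpoly_scale (sym_eval scale B g w) (sym_pullback scale B \<phi> f)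
    - mpoly_scale (sym_eval scale B f w) (sym_pullback scale B \<phi> g)"

lemma mpoly_hom_superset:
  assumes "finite M" "Poly_Mapping.keys p \<subseteq> M" "h 0 = 0"
  shows "mpoly_hom h \<sigma> p = (\<Sum>m\<in>M. h (Poly_Mapping.lookup p m) *
      (\<Prod>x\<in>Poly_Mapping.keys m. \<sigma> x ^ Poly_Mapping.lookup m x))"
  unfolding mpoly_hom_def
  by (rule sum.mono_neutral_left) (use assms in \<open>auto simp: in_keys_iff\<close>)

lemma monomial_hom_superset:
  fixes \<sigma> :: "'v \<Rightarrow> 'r::comm_ring_1"
  assumes "finite X" "Poly_Mapping.keys m \<subseteq> X"
  shows "(\<Prod>x\<in>Poly_Mapping.keys m. \<sigma> x ^ Poly_Mapping.lookup m x)
    = (\<Prod>x\<in>X. \<sigma> x ^ Poly_Mapping.lookup m x)"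
  by (rule prod.mono_neutral_left) (use assms in \<open>auto simp: in_keys_iff\<close>)

lemma monomial_hom_add:
  fixes \<sigma> :: "'v \<Rightarrow> 'r::comm_ring_1"
  shows "(\<Prod>x\<in>Poly_Mapping.keys (m + n). \<sigma> x ^ Poly_Mapping.lookup (m + n) x)
    = (\<Prod>x\<in>Poly_Mapping.keys m. \<sigma> x ^ Poly_Mapping.lookup m x)
      * (\<Prod>x\<in>Poly_Mapping.keys n. \<sigma> x ^ Poly_Mapping.lookup n x)"
proof -
  let ?X = "Poly_Mapping.keys m \<union> Poly_Mapping.keys n"
  have "Poly_Mapping.keys (m + n) \<subseteq> ?X" by (rule keys_add)
  then show ?thesis
    using monomial_hom_superset[of ?X m \<sigma>] monomial_hom_superset[of ?X n \<sigma>]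
      monomial_hom_superset[of ?X "m + n" \<sigma>]
    by (simp add: lookup_add power_add prod.distrib)
qed

locale coeff_hom =
  fixes h :: "'k::comm_ring_1 \<Rightarrow> 'r::comm_ring_1"
  assumes h_zero: "h 0 = 0" and h_one: "h 1 = 1"
    and h_add: "h (a + b) = h a + h b" and h_mult: "h (a * b) = h a * h b"
begin

lemma mpoly_hom_add: "mpoly_hom h \<sigma> (p + q) = mpoly_hom h \<sigma> p + mpoly_hom h \<sigma> q"
proof -
  let ?M = "Poly_Mapping.keys p \<union> Poly_Mapping.keys q"
  have "Poly_Mapping.keys (p + q) \<subseteq> ?M" by (rule keys_add)
  then show ?thesis
    using mpoly_hom_superset[of ?M p h \<sigma>] mpoly_hom_superset[of ?M q h \<sigma>]
      mpoly_hom_superset[of ?M "p + q" h \<sigma>]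
    by (simp add: lookup_add h_add h_zero algebra_simps sum.distrib)
qed

lemma mpoly_hom_zero: "mpoly_hom h \<sigma> 0 = 0"
  by (simp add: mpoly_hom_def)

lemma mpoly_hom_sum: "mpoly_hom h \<sigma> (sum f I) = (\<Sum>i\<in>I. mpoly_hom h \<sigma> (f i))"
  by (induction I rule: infinite_finite_induct) (auto simp: mpoly_hom_zero mpoly_hom_add)

lemma mpoly_hom_single: "mpoly_hom h \<sigma> (Poly_Mapping.single m c)
    = h c * (\<Prod>x\<in>Poly_Mapping.keys m. \<sigma> x ^ Poly_Mapping.lookup m x)"
  using mpoly_hom_superset[of "{m}" "Poly_Mapping.single m c" h \<sigma>] by (simp add: h_zero)

lemma mpoly_hom_const: "mpoly_hom h \<sigma> (mpoly_const c) = h c"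
  by (simp add: mpoly_const_def mpoly_hom_single)

lemma mpoly_hom_var: "mpoly_hom h \<sigma> (mpoly_var x) = \<sigma> x"
  by (simp add: mpoly_var_def mpoly_hom_single h_one)

lemma mpoly_hom_mult: "mpoly_hom h \<sigma> (p * q) = mpoly_hom h \<sigma> p * mpoly_hom h \<sigma> q"
proof -
  have dec: "r = (\<Sum>m\<in>Poly_Mapping.keys r. Poly_Mapping.single m (Poly_Mapping.lookup r m))"
    for r :: "('v, 'k) mpoly"
    by (rule poly_mapping_eqI)
      (auto simp: lookup_sum lookup_single when_def in_keys_iff)
  have "mpoly_hom h \<sigma> (p * q) = mpoly_hom h \<sigma>
      ((\<Sum>m\<in>Poly_Mapping.keys p. Poly_Mapping.single m (Poly_Mapping.lookup p m)) *
       (\<Sum>n\<in>Poly_Mapping.keys q. Poly_Mapping.single n (Poly_Mapping.lookup q n)))"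
    using dec[of p] dec[of q] by simp
  also have "\<dots> = mpoly_hom h \<sigma> p * mpoly_hom h \<sigma> q"
    by (simp add: sum_product mpoly_hom_sum mult_single mpoly_hom_single h_mult monomial_hom_add)
      (simp add: mpoly_hom_def sum_product mult_ac)
  finally show ?thesis .
qed

lemma mpoly_hom_scale: "mpoly_hom h \<sigma> (mpoly_scale c p) = h c * mpoly_hom h \<sigma> p"
  by (simp add: mpoly_scale_def mpoly_hom_mult mpoly_hom_const)

lemma mpoly_hom_power: "mpoly_hom h \<sigma> (p ^ n) = mpoly_hom h \<sigma> p ^ n"
  by (induction n) (use mpoly_hom_const[of \<sigma> 1] in
      \<open>simp_all add: mpoly_hom_mult h_one mpoly_const_def\<close>)

lemma mpoly_hom_prod: "mpoly_hom h \<sigma> (prod f I) = (\<Prod>i\<in>I. mpoly_hom h \<sigma> (f i))"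
  by (induction I rule: infinite_finite_induct) (use mpoly_hom_const[of \<sigma> 1] in
      \<open>simp_all add: mpoly_hom_mult h_one mpoly_const_def\<close>)

end

interpretation coeff_id: coeff_hom "\<lambda>c :: 'k::comm_ring_1. c"
  by unfold_locales simp_all

interpretation coeff_const: coeff_hom "mpoly_const :: 'k::comm_ring_1 \<Rightarrow> ('v, 'k) mpoly"
  by unfold_locales (simp_all add: mpoly_const_def single_add mult_single)

text \<open>The pullback is composition with \<open>\<phi>\<close> on the associated functions.\<close>

lemma sym_eval_pullback:
  assumes V: "finite_dimensional_vector_space scale B"
    and phi: "Vector_Spaces.linear scale scale \<phi>"
  shows "sym_eval scale B (sym_pullback scale B \<phi> f) v = sym_eval scale B f (\<phi> v)"
proof -
  interpret finite_dimensional_vector_space scale B by (rule V)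
  interpret phi: Vector_Spaces.linear scale scale \<phi> by (rule phi)
  have "\<phi> v = (\<Sum>b\<in>B. scale (representation B v b) (\<phi> b))"
    using sum_representation_eq[of B v B] independent_Basis span_Basis finite_Basis
    by (metis (no_types, lifting) UNIV_I order_refl phi.scale phi.sum sum.cong)
  then have lin: "coord scale B b (\<phi> v) = (\<Sum>c\<in>B. coord scale B b (\<phi> c) * coord scale B c v)" for b
    using independent_Basis span_Basis
    by (simp add: coord_def representation_sum representation_scale mult.commute)
  show ?thesis
    by (simp add: sym_eval_def sym_pullback_def mpoly_hom_def[of mpoly_const]
        mpoly_hom_def[of "\<lambda>c. c" _ f] coeff_id.mpoly_hom_sum coeff_id.mpoly_hom_mult
        coeff_id.mpoly_hom_const coeff_id.mpoly_hom_prod coeff_id.mpoly_hom_power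
        functional_poly_def coeff_id.mpoly_hom_scale coeff_id.mpoly_hom_var lin)
qed

end

theory Submission
  imports Defs
begin

text \<open>
  Write \<open>T\<close> for the pullback along \<open>\<phi>\<close>, \<open>e\<close> for evaluation at \<open>w\<close> and \<open>\<lambda>\<close> for the eigenvalue, so that
  \<open>[f, g] = e(g) T f - e(f) T g\<close>. Everything rests on \<open>e\<close> being an eigenfunctional of \<open>T\<close>:
  a form \<open>f\<close> of degree \<open>d\<close> satisfies \<open>e(T f) = f(\<phi> w) = f(\<lambda> w) = \<lambda>\<^sup>d e(f)\<close>. Hence \<open>e\<close> vanishes on
  every bracket, the contributions \<open>\<lambda>\<^sup>d e(f) e(g)\<close> of its two terms being equal. In a nested bracket
  only \<open>[x, [y, z]] = - e(x) T [y, z] = e(x) e(y) T\<^sup>2 z - e(x) e(z) T\<^sup>2 y\<close> survives, and its cyclic sum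
  cancels, which is the Jacobi identity. The derived algebra lies in the kernel of \<open>e\<close>, where the
  bracket is zero, so the second derived algebra vanishes: the Lie algebra is solvable.

  On the kernel of \<open>e\<close> the map \<open>[f, -]\<close> is \<open>- e(f) T\<close>. Each further term of the lower central series
  therefore lies in the image of one more power of \<open>T\<close>, and the series ends at zero as soon as \<open>T\<close> is
  nilpotent. The locale \<open>eigenfunctional\<close> carries out this part for an arbitrary linear operator with
  an eigenfunctional.

  If \<open>\<phi>\<close> is nilpotent and \<open>d > 0\<close>, functoriality (\<open>pullback_power\<close>) makes a power of \<open>T\<close> the pullback
  along the zero map, which kills every form of positive degree (\<open>pullback_zero_map\<close>). If \<open>d = 0\<close>, the
  pullback is the identity and this argument fails, but then only constants occur and the bracket
  \<open>g f - f g\<close> of two constants is zero.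
\<close>

section \<open>Brackets built from an operator and an eigenfunctional\<close>

locale eigenfunctional = vector_space scale
  for scale :: "'k::field \<Rightarrow> 'a::ab_group_add \<Rightarrow> 'a" (infixr \<open>*s\<close> 75) +
  fixes L :: "'a set" and T :: "'a \<Rightarrow> 'a" and e :: "'a \<Rightarrow> 'k" and \<mu> :: 'k
  assumes subspace_L: "subspace L"
    and T_closed: "f \<in> L \<Longrightarrow> T f \<in> L"
    and T_add: "T (f + g) = T f + T g" and T_scale: "T (c *s f) = c *s T f"
    and e_add: "e (f + g) = e f + e g" and e_scale: "e (c *s f) = c * e f"
    and e_T: "f \<in> L \<Longrightarrow> e (T f) = \<mu> * e f"
begin

definition twisted_bracket :: "'a \<Rightarrow> 'a \<Rightarrow> 'a" where
  "twisted_bracket f g = e g *s T f - e f *s T g"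

lemma T_linear: "module_hom (*s) (*s) T"
  by unfold_locales (simp_all add: T_add T_scale algebra_simps)

lemma T_diff: "T (f - g) = T f - T g"
  using T_add[of "f - g" g] by simp

lemma e_diff: "e (f - g) = e f - e g"
  using e_add[of "f - g" g] by simp

text \<open>
  In \<open>e [f, g] = e(g) e(T f) - e(f) e(T g)\<close> the eigenvalue equation makes both products equal to
  \<open>\<mu> e(f) e(g)\<close>. The Jacobi identity, solvability and nilpotency all come from this cancellation.
\<close>

lemma e_bracket: "f \<in> L \<Longrightarrow> g \<in> L \<Longrightarrow> e (twisted_bracket f g) = 0"
  by (simp add: twisted_bracket_def e_diff e_scale e_T)

sublocale lie_algebra "(*s)" L twisted_bracket
proof unfold_locales
  show "subspace L" by (rule subspace_L)
  fix x y z and c :: 'k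
  assume x: "x \<in> L" and y: "y \<in> L"
  show "twisted_bracket x y \<in> L"
    unfolding twisted_bracket_def
    by (intro subspace_diff subspace_scale subspace_L T_closed x y)
  show "twisted_bracket (x + y) z = twisted_bracket x z + twisted_bracket y z"
    and "twisted_bracket x (y + z) = twisted_bracket x y + twisted_bracket x z"
    and "twisted_bracket (c *s x) y = c *s twisted_bracket x y"
    and "twisted_bracket x (c *s y) = c *s twisted_bracket x y"
    and "twisted_bracket x x = 0"
    by (simp_all add: twisted_bracket_def T_add T_scale e_add e_scale algebra_simps)
  assume z: "z \<in> L"
  \<comment> \<open>The term in which \<open>e\<close> is applied to the inner bracket drops out; the cyclic sum of what is left
    cancels in pairs.\<close>
  have nested: "twisted_bracket f (twisted_bracket g h)
      = (e f * e g) *s T (T h) - (e f * e h) *s T (T g)" if "g \<in> L" "h \<in> L" for f g h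
    using e_bracket[OF that]
    by (simp add: twisted_bracket_def[of f] twisted_bracket_def[of g h] T_diff T_scale
        scale_right_diff_distrib)
  show "twisted_bracket x (twisted_bracket y z) + twisted_bracket y (twisted_bracket z x)
      + twisted_bracket z (twisted_bracket x y) = 0"
    by (simp add: nested x y z mult.commute)
qed

text \<open>
  The bracket takes values in this subspace, and its restriction to it is zero.
\<close>

lemma subspace_kernel: "subspace (L \<inter> {f. e f = 0})"
  using e_scale[of 0 0]
  by (auto simp: subspace_def e_add e_scale subspace_0[OF subspace_L]
      subspace_add[OF subspace_L] subspace_scale[OF subspace_L])

lemma derived_subset_kernel: "derived_series 1 \<subseteq> L \<inter> {f. e f = 0}"
  unfolding One_nat_def derived_series.simps bracket_span_def
  by (rule span_minimal[OF _ subspace_kernel]) (auto simp: e_bracket bracket_closed)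

lemma solvable: "solvable_lie_algebra (*s) L twisted_bracket"
proof unfold_locales
  have "e f = 0" if "f \<in> derived_series 1" for f
    using derived_subset_kernel that by blast
  then have "{twisted_bracket x y | x y. x \<in> derived_series 1 \<and> y \<in> derived_series 1} \<subseteq> {0}"
    by (auto simp: twisted_bracket_def simp del: One_nat_def)
  then have "derived_series (Suc 1) \<subseteq> {0}"
    unfolding derived_series.simps bracket_span_def
    by (rule span_minimal) simp
  moreover have "0 \<in> derived_series (Suc 1)"
    by (simp add: bracket_span_def span_zero)
  ultimately show "\<exists>n. derived_series n = {0}" by blast
qed

lemma T_power_linear: "module_hom (*s) (*s) (T ^^ n)"
proof (induction n)
  case 0
  show ?case by unfold_locales (simp_all add: algebra_simps)
next
  case (Suc n)
  show ?case using module_hom_compose[OF Suc T_linear] by (simp add: comp_def)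
qed

text \<open>
  A first bracket is \<open>T\<close> applied to \<open>e(g) f - e(f) g\<close>, and lies in the kernel of \<open>e\<close>. Bracketing \<open>f\<close> with
  an element \<open>g\<close> of the kernel gives \<open>- e(f) T g\<close>, which adds one power of \<open>T\<close>. The kernel is part of the
  claim because the induction step relies on \<open>e(g) = 0\<close>.
\<close>

lemma lower_central_subset_image:
  "lower_central_series (Suc k) \<subseteq> (T ^^ Suc k) ` L \<inter> (L \<inter> {f. e f = 0})"
proof (induction k)
  have sub: "subspace ((T ^^ n) ` L \<inter> (L \<inter> {f. e f = 0}))" for n
    by (intro subspace_inter subspace_kernel
        module_hom.subspace_image[OF T_power_linear] subspace_L)
  {
    case 0
    have "twisted_bracket f g \<in> T ` L" if "f \<in> L" "g \<in> L" for f g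
    proof
      show "twisted_bracket f g = T (e g *s f - e f *s g)"
        by (simp add: twisted_bracket_def T_diff T_scale)
      show "e g *s f - e f *s g \<in> L"
        by (intro subspace_diff subspace_scale subspace_L that)
    qed
    then show ?case
      unfolding lower_central_series.simps bracket_span_def
      by (intro span_minimal sub) (auto simp: e_bracket bracket_closed)
  next
    case (Suc k)
    have "twisted_bracket f g \<in> (T ^^ Suc (Suc k)) ` L"
      if f: "f \<in> L" and g: "g \<in> lower_central_series (Suc k)" for f g
    proof -
      obtain h where h: "h \<in> L" "g = (T ^^ Suc k) h" and "e g = 0"
        using Suc g by blast
      then have "twisted_bracket f g = (- e f) *s (T ^^ Suc (Suc k)) h"
        by (simp add: twisted_bracket_def)
      also have "\<dots> = (T ^^ Suc (Suc k)) ((- e f) *s h)"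
        using module_hom.scale[OF T_power_linear] by metis
      finally show ?thesis
        using subspace_scale[OF subspace_L h(1)] by blast
    qed
    moreover have "lower_central_series (Suc k) \<subseteq> L"
      using Suc by blast
    ultimately show ?case
      unfolding lower_central_series.simps(2)[of "Suc k"] bracket_span_def
      by (intro span_minimal sub) (auto simp: e_bracket bracket_closed subset_iff
          simp del: lower_central_series.simps funpow.simps)
  }
qed

lemma nilpotent_if_operator_nilpotent:
  assumes "\<And>f. f \<in> L \<Longrightarrow> (T ^^ Suc n) f = 0"
  shows "nilpotent_lie_algebra (*s) L twisted_bracket"
proof unfold_locales
  have "lower_central_series (Suc n) \<subseteq> {0}"
    using lower_central_subset_image[of n] assms by blast
  moreover have "0 \<in> lower_central_series (Suc n)"
    by (simp add: bracket_span_def span_zero)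
  ultimately show "\<exists>n. lower_central_series n = {0}" by blast
qed

end

lemma (in lie_algebra) nilpotent_if_abelian:
  assumes "\<And>x y. x \<in> L \<Longrightarrow> y \<in> L \<Longrightarrow> bracket x y = 0"
  shows "nilpotent_lie_algebra (*s) L bracket"
proof unfold_locales
  have "lower_central_series (Suc 0) \<subseteq> {0}"
    unfolding lower_central_series.simps bracket_span_def
    by (rule span_minimal) (auto simp: assms)
  moreover have "0 \<in> lower_central_series (Suc 0)"
    by (simp add: bracket_span_def span_zero)
  ultimately show "\<exists>n. lower_central_series n = {0}" by blast
qed


section \<open>Homogeneous polynomials\<close>

lemma vector_space_mpoly: "vector_space (mpoly_scale :: 'k::field \<Rightarrow> ('v, 'k) mpoly \<Rightarrow> _)"
  by unfold_locales
    (simp_all add: mpoly_scale_def coeff_const.h_add coeff_const.h_mult coeff_const.h_one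
      algebra_simps)

lemma sum_lookup_superset:
  fixes m :: "'v \<Rightarrow>\<^sub>0 nat"
  assumes "finite X" "Poly_Mapping.keys m \<subseteq> X"
  shows "(\<Sum>b\<in>Poly_Mapping.keys m. Poly_Mapping.lookup m b)
    = (\<Sum>b\<in>X. Poly_Mapping.lookup m b)"
  by (rule sum.mono_neutral_left) (use assms in \<open>auto simp: in_keys_iff\<close>)

lemma sum_lookup_add:
  fixes m n :: "'v \<Rightarrow>\<^sub>0 nat"
  shows "(\<Sum>b\<in>Poly_Mapping.keys (m + n). Poly_Mapping.lookup (m + n) b)
    = (\<Sum>b\<in>Poly_Mapping.keys m. Poly_Mapping.lookup m b)
      + (\<Sum>b\<in>Poly_Mapping.keys n. Poly_Mapping.lookup n b)"
proof -
  let ?X = "Poly_Mapping.keys m \<union> Poly_Mapping.keys n"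
  have "Poly_Mapping.keys (m + n) \<subseteq> ?X" by (rule keys_add)
  then show ?thesis
    using sum_lookup_superset[of ?X m] sum_lookup_superset[of ?X n]
      sum_lookup_superset[of ?X "m + n"]
    by (simp add: lookup_add sum.distrib)
qed

lemma zero_in_sym_power: "0 \<in> sym_power_dual B d"
  by (simp add: sym_power_dual_def)

lemma add_in_sym_power:
  assumes "p \<in> sym_power_dual B d" "q \<in> sym_power_dual B d"
  shows "p + q \<in> sym_power_dual B d"
  using assms keys_add[of p q] by (fastforce simp: sym_power_dual_def)

lemma sum_in_sym_power:
  "(\<And>i. i \<in> I \<Longrightarrow> p i \<in> sym_power_dual B d) \<Longrightarrow> sum p I \<in> sym_power_dual B d"
  by (induction I rule: infinite_finite_induct)
    (auto intro: add_in_sym_power simp: zero_in_sym_power)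

lemma const_in_sym_power: "mpoly_const c \<in> sym_power_dual B 0"
  by (simp add: sym_power_dual_def mpoly_const_def)

lemma var_in_sym_power: "b \<in> B \<Longrightarrow> mpoly_var b \<in> sym_power_dual B 1"
  by (simp add: sym_power_dual_def mpoly_var_def)

lemma mult_in_sym_power:
  assumes "p \<in> sym_power_dual B d" "q \<in> sym_power_dual B d'"
  shows "p * q \<in> sym_power_dual B (d + d')"
  unfolding sym_power_dual_def
proof (intro CollectI ballI conjI)
  fix m assume "m \<in> Poly_Mapping.keys (p * q)"
  then obtain a b where m: "m = a + b" and
    a: "a \<in> Poly_Mapping.keys p" and b: "b \<in> Poly_Mapping.keys q"
    using keys_mult[of p q] by blast
  show "Poly_Mapping.keys m \<subseteq> B"
    using assms a b keys_add[of a b] unfolding sym_power_dual_def m by blast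
  show "(\<Sum>b\<in>Poly_Mapping.keys m. Poly_Mapping.lookup m b) = d + d'"
    using assms a b by (simp add: sym_power_dual_def m sum_lookup_add)
qed

lemma scale_in_sym_power: "p \<in> sym_power_dual B d \<Longrightarrow> mpoly_scale c p \<in> sym_power_dual B d"
  using mult_in_sym_power[OF const_in_sym_power, of p B d c] by (simp add: mpoly_scale_def)

lemma one_in_sym_power: "1 \<in> sym_power_dual B 0"
  using const_in_sym_power[of 1 B] by (simp add: coeff_const.h_one)

lemma power_in_sym_power: "p \<in> sym_power_dual B d \<Longrightarrow> p ^ n \<in> sym_power_dual B (n * d)"
  by (induction n) (auto simp: one_in_sym_power intro: mult_in_sym_power)

lemma prod_in_sym_power:
  "(\<And>i. i \<in> I \<Longrightarrow> p i \<in> sym_power_dual B (d i)) \<Longrightarrow> prod p I \<in> sym_power_dual B (sum d I)"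
  by (induction I rule: infinite_finite_induct)
    (auto simp: one_in_sym_power intro: mult_in_sym_power)

lemma functional_poly_in_sym_power: "functional_poly B l \<in> sym_power_dual B 1"
  unfolding functional_poly_def
  by (intro sum_in_sym_power scale_in_sym_power var_in_sym_power)

lemma subspace_sym_power: "module.subspace mpoly_scale (sym_power_dual B d)"
proof -
  interpret vector_space mpoly_scale by (rule vector_space_mpoly)
  show ?thesis
    by (simp add: subspace_def zero_in_sym_power add_in_sym_power scale_in_sym_power)
qed


section \<open>Evaluation and pullback\<close>

lemma pullback_in_sym_power:
  assumes "f \<in> sym_power_dual B d"
  shows "sym_pullback scale B \<phi> f \<in> sym_power_dual B d"
  unfolding sym_pullback_def mpoly_hom_def
proof (rule sum_in_sym_power)
  fix m assume m: "m \<in> Poly_Mapping.keys f"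
  let ?l = "\<lambda>b. functional_poly B (coord scale B b \<circ> \<phi>)"
  have "(\<Prod>b\<in>Poly_Mapping.keys m. ?l b ^ Poly_Mapping.lookup m b)
      \<in> sym_power_dual B (\<Sum>b\<in>Poly_Mapping.keys m. Poly_Mapping.lookup m b)"
    using power_in_sym_power[OF functional_poly_in_sym_power]
    by (intro prod_in_sym_power) simp
  also have "(\<Sum>b\<in>Poly_Mapping.keys m. Poly_Mapping.lookup m b) = d"
    using assms m by (simp add: sym_power_dual_def)
  finally show "mpoly_const (Poly_Mapping.lookup f m)
      * (\<Prod>b\<in>Poly_Mapping.keys m. ?l b ^ Poly_Mapping.lookup m b) \<in> sym_power_dual B d"
    by (rule mult_in_sym_power[OF const_in_sym_power, of _ B d, unfolded add_0])
qed

text \<open>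
  This homogeneity is what turns an eigenvector of \<open>\<phi>\<close> into an eigenfunctional of the pullback: the
  factor \<open>c ^ d\<close> is the same for all forms of degree \<open>d\<close>.
\<close>

lemma sym_eval_scale_vector:
  assumes V: "finite_dimensional_vector_space scale B" and f: "f \<in> sym_power_dual B d"
  shows "sym_eval scale B f (scale c v) = c ^ d * sym_eval scale B f v"
proof -
  interpret finite_dimensional_vector_space scale B by (rule V)
  have coord: "coord scale B b (scale c v) = c * coord scale B b v" for b
    using independent_Basis span_Basis by (simp add: coord_def representation_scale)
  have "(\<Prod>b\<in>Poly_Mapping.keys m. c ^ Poly_Mapping.lookup m b) = c ^ d"
    if "m \<in> Poly_Mapping.keys f" for m
    using f that by (simp add: sym_power_dual_def flip: power_sum)
  then show ?thesis
    by (simp add: sym_eval_def mpoly_hom_def coord power_mult_distrib prod.distrib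
        sum_distrib_left mult_ac cong: sum.cong)
qed

text \<open>
  The next three lemmas give the functoriality of the pullback. Equality of the associated functions
  would not suffice over a finite field, so it is established for the substitution itself: a
  substitution is determined by its values on variables, and these are linear forms, for which
  functoriality is the expansion of a functional in the dual basis.
\<close>

lemma pullback_functional_poly:
  assumes V: "finite_dimensional_vector_space scale B"
    and l: "Vector_Spaces.linear scale (*) l"
  shows "sym_pullback scale B \<phi> (functional_poly B l) = functional_poly B (l \<circ> \<phi>)"
proof -
  interpret finite_dimensional_vector_space scale B by (rule V)
  interpret l: Vector_Spaces.linear scale "(*)" l by (rule l)
  have expand: "l v = (\<Sum>b\<in>B. l b * coord scale B b v)" for v
  proof -
    have "l v = l (\<Sum>b\<in>B. scale (representation B v b) b)"
      using sum_representation_eq[of B v B] independent_Basis span_Basis finite_Basis by simp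
    then show ?thesis
      by (simp add: l.sum l.scale coord_def mult.commute)
  qed
  have "sym_pullback scale B \<phi> (functional_poly B l)
      = (\<Sum>b\<in>B. \<Sum>c\<in>B. mpoly_const (l b * coord scale B b (\<phi> c)) * mpoly_var c)"
    by (simp add: sym_pullback_def functional_poly_def coeff_const.mpoly_hom_sum
        coeff_const.mpoly_hom_scale coeff_const.mpoly_hom_mult coeff_const.mpoly_hom_const
        coeff_const.mpoly_hom_var mpoly_scale_def
        sum_distrib_left coeff_const.h_mult mult.assoc)
  also have "\<dots> = (\<Sum>c\<in>B. \<Sum>b\<in>B. mpoly_const (l b * coord scale B b (\<phi> c)) * mpoly_var c)"
    by (rule sum.swap)
  also have "\<dots> = (\<Sum>c\<in>B. mpoly_const (\<Sum>b\<in>B. l b * coord scale B b (\<phi> c)) * mpoly_var c)"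
  proof -
    have "mpoly_const (sum h I) = (\<Sum>i\<in>I. (mpoly_const (h i) :: ('b, 'a) mpoly))"
      for h :: "'b \<Rightarrow> 'a" and I
      by (induction I rule: infinite_finite_induct)
        (simp_all add: coeff_const.h_zero coeff_const.h_add)
    then show ?thesis by (simp add: sum_distrib_right)
  qed
  also have "\<dots> = functional_poly B (l \<circ> \<phi>)"
    by (simp add: functional_poly_def mpoly_scale_def flip: expand)
  finally show ?thesis .
qed

lemma mpoly_hom_mpoly_hom:
  "mpoly_hom mpoly_const \<sigma> (mpoly_hom mpoly_const \<tau> f)
    = mpoly_hom mpoly_const (\<lambda>b. mpoly_hom mpoly_const \<sigma> (\<tau> b)) f"
  by (simp add: mpoly_hom_def[of mpoly_const _ f] coeff_const.mpoly_hom_sum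
      coeff_const.mpoly_hom_mult coeff_const.mpoly_hom_const coeff_const.mpoly_hom_prod
      coeff_const.mpoly_hom_power)

lemma pullback_pullback:
  assumes V: "finite_dimensional_vector_space scale B"
    and psi: "Vector_Spaces.linear scale scale \<psi>"
  shows "sym_pullback scale B \<phi> (sym_pullback scale B \<psi> f) = sym_pullback scale B (\<psi> \<circ> \<phi>) f"
proof -
  interpret finite_dimensional_vector_space scale B by (rule V)
  interpret psi: Vector_Spaces.linear scale scale \<psi> by (rule psi)
  have "Vector_Spaces.linear scale (*) (coord scale B b \<circ> \<psi>)" for b
    by unfold_locales (use independent_Basis span_Basis in
        \<open>simp_all add: coord_def psi.add psi.scale representation_add representation_scale
          algebra_simps\<close>)
  then have "sym_pullback scale B \<phi> (functional_poly B (coord scale B b \<circ> \<psi>))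
      = functional_poly B (coord scale B b \<circ> (\<psi> \<circ> \<phi>))" for b
    by (simp add: pullback_functional_poly[OF V] comp_assoc)
  then show ?thesis
    by (simp add: sym_pullback_def mpoly_hom_mpoly_hom)
qed

text \<open>
  The exponents are positive because the pullback along the identity fixes only the polynomials
  in the variables from \<open>B\<close>, while the formula holds for every \<open>f\<close>.
\<close>

lemma pullback_power:
  assumes V: "finite_dimensional_vector_space scale B"
    and phi: "Vector_Spaces.linear scale scale \<phi>"
  shows "(sym_pullback scale B \<phi> ^^ Suc n) f = sym_pullback scale B (\<phi> ^^ Suc n) f"
proof (induction n arbitrary: f)
  case 0
  show ?case by simp
next
  case (Suc n)
  have "(sym_pullback scale B \<phi> ^^ Suc (Suc n)) f
      = (sym_pullback scale B \<phi> ^^ Suc n) (sym_pullback scale B \<phi> f)"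
    by (simp add: funpow_swap1)
  also have "\<dots> = sym_pullback scale B (\<phi> ^^ Suc n) (sym_pullback scale B \<phi> f)"
    by (rule Suc.IH)
  also have "\<dots> = sym_pullback scale B (\<phi> ^^ Suc (Suc n)) f"
    using pullback_pullback[OF V phi] by simp
  finally show ?case .
qed

text \<open>
  Every monomial of positive degree contains some variable with a positive exponent, and all variables
  are sent to zero. Constants are fixed, so degree zero has to be excluded.
\<close>

lemma pullback_zero_map:
  assumes V: "finite_dimensional_vector_space scale B"
    and zero: "\<And>v. \<phi> v = 0" and f: "f \<in> sym_power_dual B d" and d: "d \<noteq> 0"
  shows "sym_pullback scale B \<phi> f = 0"
  unfolding sym_pullback_def mpoly_hom_def
proof (intro sum.neutral ballI)
  interpret finite_dimensional_vector_space scale B by (rule V)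
  have l: "functional_poly B (coord scale B b \<circ> \<phi>) = 0" for b
    using independent_Basis
    by (simp add: functional_poly_def coord_def zero representation_zero mpoly_scale_def
        coeff_const.h_zero)
  fix m assume "m \<in> Poly_Mapping.keys f"
  then have "(\<Sum>b\<in>Poly_Mapping.keys m. Poly_Mapping.lookup m b) \<noteq> 0"
    using f d by (simp add: sym_power_dual_def)
  then obtain b where "b \<in> Poly_Mapping.keys m" "Poly_Mapping.lookup m b \<noteq> 0"
    by (meson sum.neutral)
  then have "(\<Prod>b\<in>Poly_Mapping.keys m. functional_poly B (coord scale B b \<circ> \<phi>)
      ^ Poly_Mapping.lookup m b) = 0"
    by (intro prod_zero bexI[of _ b]) (simp_all add: l zero_power)
  then show "mpoly_const (Poly_Mapping.lookup f m)
      * (\<Prod>b\<in>Poly_Mapping.keys m. functional_poly B (coord scale B b \<circ> \<phi>)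
      ^ Poly_Mapping.lookup m b) = 0"
    by simp
qed

lemma sym_power_0_const:
  assumes "f \<in> sym_power_dual B 0"
  obtains c where "f = mpoly_const c"
proof
  show "f = mpoly_const (Poly_Mapping.lookup f 0)"
  proof (rule poly_mapping_eqI)
    fix m
    have "m = 0" if "m \<in> Poly_Mapping.keys f"
      using assms that
      by (auto simp: sym_power_dual_def in_keys_iff intro!: poly_mapping_eqI)
    then show "Poly_Mapping.lookup f m
        = Poly_Mapping.lookup (mpoly_const (Poly_Mapping.lookup f 0)) m"
      by (cases "m = 0") (auto simp: mpoly_const_def lookup_single when_def in_keys_iff)
  qed
qed


section \<open>The Lie algebra of forms\<close>

theorem theorem2p1:
  fixes scale :: "'k::field \<Rightarrow> 'v::ab_group_add \<Rightarrow> 'v"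
    and B :: "'v set" and \<phi> :: "'v \<Rightarrow> 'v" and w :: 'v and ev :: 'k and d :: nat
  assumes "finite_dimensional_vector_space scale B"
    and "Vector_Spaces.linear scale scale \<phi>"
    and "w \<noteq> 0" and "\<phi> w = scale ev w"
  shows "solvable_lie_algebra mpoly_scale
      (sym_power_dual B d :: ('v, 'k) mpoly set) (sym_bracket scale B \<phi> w) \<and>
    ((\<exists>n. \<forall>v. (\<phi> ^^ n) v = 0) \<longrightarrow>
      nilpotent_lie_algebra mpoly_scale
        (sym_power_dual B d :: ('v, 'k) mpoly set) (sym_bracket scale B \<phi> w))"
proof -
  note V = assms(1) and phi = assms(2)
  let ?L = "sym_power_dual B d :: ('v, 'k) mpoly set"
  let ?T = "sym_pullback scale B \<phi>" and ?e = "\<lambda>f. sym_eval scale B f w"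
  have eigen: "eigenfunctional mpoly_scale ?L ?T ?e (ev ^ d)"
  proof (intro eigenfunctional.intro eigenfunctional_axioms.intro vector_space_mpoly)
    show "module.subspace mpoly_scale ?L" by (rule subspace_sym_power)
  next
    fix f assume f: "f \<in> ?L"
    show "?T f \<in> ?L" using f by (rule pullback_in_sym_power)
    show "?e (?T f) = ev ^ d * ?e f"
      using sym_eval_scale_vector[OF V f] by (simp add: sym_eval_pullback[OF V phi] assms(4))
  qed (simp_all add: sym_pullback_def sym_eval_def coeff_const.mpoly_hom_add
      coeff_const.mpoly_hom_scale coeff_id.mpoly_hom_add coeff_id.mpoly_hom_scale mpoly_scale_def
      coeff_const.mpoly_hom_mult coeff_const.mpoly_hom_const coeff_id.mpoly_hom_mult
      coeff_id.mpoly_hom_const)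
  interpret eigenfunctional mpoly_scale ?L ?T ?e "ev ^ d" by (rule eigen)
  have br: "sym_bracket scale B \<phi> w = twisted_bracket"
    by (intro ext) (simp add: sym_bracket_def twisted_bracket_def)
  have "nilpotent_lie_algebra mpoly_scale ?L twisted_bracket"
    if nil: "\<forall>v. (\<phi> ^^ n) v = 0" for n
  proof (cases "d = 0")
    case True
    show ?thesis
    proof (rule nilpotent_if_abelian)
      fix f g assume "f \<in> ?L" "g \<in> ?L"
      then obtain a b where "f = mpoly_const a" "g = mpoly_const b"
        using sym_power_0_const True by metis
      then show "twisted_bracket f g = 0"
        unfolding twisted_bracket_def
        by (simp add: sym_eval_def sym_pullback_def coeff_const.mpoly_hom_const
            coeff_id.mpoly_hom_const mpoly_scale_def mult.commute)
    qed
  next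
    case False
    interpret phi: Vector_Spaces.linear scale scale \<phi> by (rule phi)
    \<comment> \<open>Passing to the next power provides the positive exponent that functoriality asks for, even if
      \<open>n = 0\<close>.\<close>
    have "(\<phi> ^^ Suc n) v = 0" for v
      using nil by simp
    then show ?thesis
      using pullback_zero_map[OF V _ _ False] pullback_power[OF V phi]
      by (intro nilpotent_if_operator_nilpotent[of n]) metis
  qed
  then show ?thesis
    using solvable by (auto simp: br)
qed

end
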